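(* Let $n,d\ge 1$ and $1\le k\le n$ be integers, let $v_1,\dots,v_n\in\mathbb{R}^d$, and let $\Lambda\in\mathbb{R}^{d\times d}$ be a (symmetric) positive definite matrix. For $S\subseteq[n]$ let $f(S)=\mathrm{tr}\big((\Lambda+\sum_{i\in S}v_iv_i^\top)^{-1}\big)$, and let $h_{\max}=\max_{i\in[n]}v_i^\top\Lambda^{-1}v_i$. Let $S^\star$ be a minimizer of $f$ over all $S\subseteq[n]$ with $|S|=k$, and let $S_{\mathrm{greedy}}$ be any set of size $k$ returned by the greedy algorithm (with arbitrary tie-breaking). Then $$\frac{f(S_{\mathrm{greedy}})}{f(S^\star)}\le h_{\max}+\frac{1}{1-1/e}.$$
   Context: Notation: $[n]=\{1,\dots,n\}$. The quantity $h_{\max}$ is called the maximum initial leverage score. Greedy algorithm: set $S_0=\emptyset$; for $t=1,\dots,k$ choose any $i_t\in\arg\min_{i\in[n]\setminus S_{t-1}}f(S_{t-1}\cup\{i\})$ and set $S_t=S_{t-1}\cup\{i_t\}$; return $S_{\mathrm{greedy}}=S_k$. The result is required to hold for every choice of tie-breaking in the $\arg\min$. *)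

theory Defs
  imports "HOL-Analysis.Analysis"
begin

definition outer_self :: "real ^ 'd \<Rightarrow> real ^ 'd ^ 'd" where
  "outer_self v = (\<chi> i j. v $ i * v $ j)"

text \<open>Symmetry is part of the notion.\<close>

definition pos_def :: "real ^ 'd ^ 'd \<Rightarrow> bool" where
  "pos_def A \<longleftrightarrow> transpose A = A \<and> (\<forall>x. x \<noteq> 0 \<longrightarrow> x \<bullet> (A *v x) > 0)"

definition A_objective ::
    "real ^ 'd ^ 'd \<Rightarrow> (nat \<Rightarrow> real ^ 'd) \<Rightarrow> nat set \<Rightarrow> real" where
  "A_objective \<Lambda> v S = trace (matrix_inv (\<Lambda> + (\<Sum>i\<in>S. outer_self (v i))))"

definition h_max :: "real ^ 'd ^ 'd \<Rightarrow> (nat \<Rightarrow> real ^ 'd) \<Rightarrow> nat \<Rightarrow> real" where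
  "h_max \<Lambda> v n = Max ((\<lambda>i. v i \<bullet> (matrix_inv \<Lambda> *v v i)) ` {1..n})"

text \<open>\<open>greedy_output f U t S\<close>: some tie-breaking of the greedy minimization of \<open>f\<close> over the
  ground set \<open>U\<close> yields \<open>S\<close> after \<open>t\<close> steps.\<close>

inductive greedy_output :: "('a set \<Rightarrow> real) \<Rightarrow> 'a set \<Rightarrow> nat \<Rightarrow> 'a set \<Rightarrow> bool"
  for f :: "'a set \<Rightarrow> real" and U :: "'a set" where
  greedy_start: "greedy_output f U 0 {}"
| greedy_step:
    "\<lbrakk>greedy_output f U t S; is_arg_min (\<lambda>i. f (S \<union> {i})) (\<lambda>i. i \<in> U - S) j\<rbrakk>
      \<Longrightarrow> greedy_output f U (Suc t) (S \<union> {j})"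

end

theory Submission
  imports Defs
begin

text \<open>Let \<open>A\<close> be the inverse of the current greedy matrix and \<open>M\<close> the matrix of the optimal set
  \<open>T\<close>. Cauchy--Schwarz gives \<open>(tr A)\<^sup>2 \<le> f T * tr (A M A)\<close>, and \<open>tr (A M A)\<close> exceeds \<open>tr A\<close> by at
  most the sum of the \<open>\<parallel>A v\<^sub>i\<parallel>\<^sup>2\<close> over \<open>T - S\<close>. By Sherman--Morrison each such term is at most
  \<open>1 + h\<close> times the greedy gain, where \<open>h\<close> is the maximum initial leverage score. So the ratio
  \<open>x\<^sub>t = f S\<^sub>t / f T\<close> satisfies the logistic recursion \<open>x\<^sub>t (x\<^sub>t - 1) \<le> k (1 + h) (x\<^sub>t - x\<^sub>t\<^sub>+\<^sub>1)\<close>, under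
  which \<open>1 - 1 / x\<^sub>t\<close> contracts by the factor \<open>1 - 1 / (k (1 + h))\<close>, whatever the value of \<open>x\<^sub>0\<close>.
  Hence \<open>x\<^sub>k \<le> 1 / (1 - exp (- u))\<close> with \<open>u = 1 / (1 + h)\<close>, and the claim follows because
  \<open>1 / (1 - exp (- u)) - 1 / u\<close> is increasing on \<open>(0, 1]\<close>.\<close>

section \<open>Rank-one matrices, positive definite matrices and their inverses\<close>

lemma outer_self_mult: "outer_self v *v x = (v \<bullet> x) *\<^sub>R (v :: real ^ 'd)"
  by (simp add: outer_self_def matrix_vector_mult_def vec_eq_iff inner_vec_def sum_distrib_left
      mult_ac)

lemma transpose_outer_self: "transpose (outer_self v) = outer_self (v :: real ^ 'd)"
  by (simp add: outer_self_def transpose_def vec_eq_iff mult_ac)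

lemma trace_eq_sum_axis: "trace (A :: real ^ 'd ^ 'd) = (\<Sum>i\<in>UNIV. axis i 1 \<bullet> (A *v axis i 1))"
  by (simp add: trace_def inner_axis' matrix_vector_mult_basis column_def)

lemma norm_sq_eq_sum_axis:
  "(norm (x :: real ^ 'd))\<^sup>2 = (\<Sum>i\<in>UNIV. (x \<bullet> axis i 1)\<^sup>2)"
  by (simp add: norm_vec_def L2_set_def sum_nonneg inner_axis)

lemma pos_defD: "pos_def A \<Longrightarrow> x \<noteq> 0 \<Longrightarrow> x \<bullet> (A *v x) > 0"
  by (simp add: pos_def_def)

lemma pos_def_nonneg: "pos_def A \<Longrightarrow> x \<bullet> (A *v x) \<ge> 0"
  by (cases "x = 0") (auto dest!: pos_defD[of A x])

lemma pos_def_swap: "pos_def A \<Longrightarrow> x \<bullet> (A *v y) = (A *v x) \<bullet> (y :: real ^ 'd)"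
  using dot_lmul_matrix[of x A y] vector_transpose_matrix[of x A] by (simp add: pos_def_def)

lemma pos_def_invertible:
  assumes "pos_def (A :: real ^ 'd ^ 'd)"
  shows "invertible A"
proof -
  have "x = 0" if "A *v x = 0" for x
    using pos_defD[OF assms, of x] that by force
  then show ?thesis
    unfolding invertible_left_inverse matrix_left_invertible_ker by blast
qed

lemma matrix_inv_mult:
  assumes "invertible A"
  shows "A ** matrix_inv A = mat 1" and "matrix_inv A ** A = mat 1"
  using someI_ex[OF assms[unfolded invertible_def]] by (simp_all add: matrix_inv_def)

lemma pos_def_mult_inv:
  assumes "pos_def (A :: real ^ 'd ^ 'd)"
  shows "A *v (matrix_inv A *v x) = x" and "matrix_inv A *v (A *v x) = x"
  by (simp_all add: matrix_vector_mul_assoc matrix_inv_mult[OF pos_def_invertible[OF assms]])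

lemma pos_def_matrix_inv:
  assumes "pos_def (A :: real ^ 'd ^ 'd)"
  shows "pos_def (matrix_inv A)"
proof -
  let ?B = "matrix_inv A"
  have swap: "x \<bullet> (?B *v y) = (?B *v x) \<bullet> y" for x y
    using pos_def_swap[OF assms, of "?B *v x" "?B *v y"] by (simp add: pos_def_mult_inv[OF assms])
  have "(transpose ?B *v x) \<bullet> y = (?B *v x) \<bullet> y" for x y
    using dot_lmul_matrix[of x ?B y] transpose_matrix_vector[of ?B x] swap[of x y] by simp
  then have "transpose ?B *v x = ?B *v x" for x
    using vector_eq_rdot by blast
  then have "transpose ?B = ?B"
    by (simp add: matrix_eq)
  moreover have "x \<bullet> (?B *v x) > 0" if "x \<noteq> 0" for x
  proof -
    have "?B *v x \<noteq> 0"
      using that pos_def_mult_inv(1)[OF assms, of x] by auto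
    from pos_defD[OF assms this] show ?thesis
      by (simp add: pos_def_mult_inv[OF assms] inner_commute)
  qed
  ultimately show ?thesis
    by (simp add: pos_def_def)
qed

lemma pos_def_add_outer_self:
  assumes "pos_def (A :: real ^ 'd ^ 'd)"
  shows "pos_def (A + outer_self v)"
  unfolding pos_def_def
proof (intro conjI allI impI)
  show "transpose (A + outer_self v) = A + outer_self v"
    using assms transpose_outer_self[of v]
    by (simp add: pos_def_def transpose_def vec_eq_iff)
  show "x \<bullet> ((A + outer_self v) *v x) > 0" if "x \<noteq> 0" for x
    using pos_defD[OF assms that]
    by (simp add: matrix_vector_mult_add_rdistrib outer_self_mult inner_add_right inner_commute
        add_pos_nonneg)
qed

lemma pos_def_add_sum_outer_self:
  assumes "pos_def (A :: real ^ 'd ^ 'd)" "finite S"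
  shows "pos_def (A + (\<Sum>i\<in>S. outer_self (v i)))"
  using assms(2)
proof (induction rule: finite_induct)
  case (insert i S)
  then show ?case
    using pos_def_add_outer_self[of "A + (\<Sum>i\<in>S. outer_self (v i))" "v i"]
    by (simp add: add_ac)
qed (use assms in simp)

lemma quadratic_add_sum_outer_self:
  fixes A :: "real ^ 'd ^ 'd"
  assumes "finite S"
  shows "x \<bullet> ((A + (\<Sum>i\<in>S. outer_self (v i))) *v x) = x \<bullet> (A *v x) + (\<Sum>i\<in>S. (v i \<bullet> x)\<^sup>2)"
  using assms
proof (induction rule: finite_induct)
  case (insert i S)
  have "A + (\<Sum>i\<in>insert i S. outer_self (v i)) = (A + (\<Sum>i\<in>S. outer_self (v i))) + outer_self (v i)"
    using insert by (simp add: add_ac)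
  then show ?case
    using insert
    by (simp only: matrix_vector_mult_add_rdistrib outer_self_mult inner_add_right)
      (simp add: power2_eq_square inner_commute)
qed simp

section \<open>Inequalities and identities for inverses and their traces\<close>

lemma trace_matrix_inv_pos:
  assumes "pos_def (A :: real ^ 'd ^ 'd)"
  shows "trace (matrix_inv A) > 0"
  unfolding trace_eq_sum_axis
  by (intro sum_pos pos_defD pos_def_matrix_inv assms) (auto simp: axis_eq_0_iff)

text \<open>Completing the square: the form of \<open>B\<close> is nonnegative at
  \<open>x - c *\<^sub>R (matrix_inv B *v y)\<close>. The scalar \<open>c\<close> stays free so that
  it can be optimized after summation over a basis.\<close>

lemma pos_def_inner_le:
  assumes B: "pos_def (B :: real ^ 'd ^ 'd)"
  shows "2 * c * (x \<bullet> y) \<le> x \<bullet> (B *v x) + c\<^sup>2 * (y \<bullet> (matrix_inv B *v y))"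
proof -
  let ?w = "x - c *\<^sub>R (matrix_inv B *v y)"
  have "0 \<le> ?w \<bullet> (B *v ?w)"
    by (rule pos_def_nonneg[OF B])
  also have "B *v ?w = B *v x - c *\<^sub>R y"
    by (simp add: matrix_vector_mult_diff_distrib matrix_vector_mult_scaleR pos_def_mult_inv[OF B])
  also have "?w \<bullet> (B *v x - c *\<^sub>R y) =
      x \<bullet> (B *v x) - 2 * c * (x \<bullet> y) + c\<^sup>2 * (y \<bullet> (matrix_inv B *v y))"
    using pos_def_swap[OF B, of "matrix_inv B *v y" x]
    by (simp add: inner_diff_left inner_diff_right pos_def_mult_inv[OF B]
        inner_commute[of _ y] inner_commute[of x y] power2_eq_square algebra_simps)
  finally show ?thesis by simp
qed

text \<open>The Cauchy--Schwarz inequality for the trace inner product of \<open>B\<^sup>-\<^sup>1\<^sup>/\<^sup>2\<close> and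
  \<open>B\<^sup>1\<^sup>/\<^sup>2 A\<close>, stated without matrix square roots.\<close>

lemma trace_sq_le:
  assumes B: "pos_def (B :: real ^ 'd ^ 'd)"
  shows "(trace A)\<^sup>2 / trace (matrix_inv B)
    \<le> (\<Sum>i\<in>UNIV. (A *v axis i 1) \<bullet> (B *v (A *v axis i 1)))"
proof -
  let ?b = "trace (matrix_inv B)"
  \<comment> \<open>The maximizer of \<open>2 * c * trace A - c\<^sup>2 * ?b\<close>, with one value
    for all basis vectors.\<close>
  define c where "c = trace A / ?b"
  have b: "?b > 0"
    by (rule trace_matrix_inv_pos[OF B])
  have "(\<Sum>i\<in>UNIV. 2 * c * ((A *v axis i 1) \<bullet> axis i 1))
     \<le> (\<Sum>i\<in>UNIV. (A *v axis i 1) \<bullet> (B *v (A *v axis i 1))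
           + c\<^sup>2 * (axis i 1 \<bullet> (matrix_inv B *v axis i 1)))"
    by (intro sum_mono pos_def_inner_le B)
  then have "2 * c * trace A
     \<le> (\<Sum>i\<in>UNIV. (A *v axis i 1) \<bullet> (B *v (A *v axis i 1))) + c\<^sup>2 * ?b"
    by (simp add: trace_eq_sum_axis sum.distrib sum_distrib_left inner_commute)
  moreover have "2 * c * trace A - c\<^sup>2 * ?b = (trace A)\<^sup>2 / ?b"
    using b by (simp add: c_def field_simps power2_eq_square)
  ultimately show ?thesis by simp
qed

text \<open>Sherman--Morrison, at the level of traces.\<close>

lemma trace_matrix_inv_add_outer_self:
  assumes A: "pos_def (A :: real ^ 'd ^ 'd)"
  shows "trace (matrix_inv A) - trace (matrix_inv (A + outer_self v))
    = (norm (matrix_inv A *v v))\<^sup>2 / (1 + v \<bullet> (matrix_inv A *v v))"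
proof -
  let ?B = "matrix_inv A" and ?C = "matrix_inv (A + outer_self v)"
  define q where "q = 1 + v \<bullet> (?B *v v)"
  have q: "q > 0"
    using pos_def_nonneg[OF pos_def_matrix_inv[OF A], of v] by (simp add: q_def)
  have C: "?C *v y = ?B *v y - ((v \<bullet> (?B *v y)) / q) *\<^sub>R (?B *v v)" (is "_ = ?z") for y
  proof -
    define c where "c = (v \<bullet> (?B *v y)) / q"
    have "v \<bullet> (?B *v y) = c * q"
      using q by (simp add: c_def)
    then have c: "v \<bullet> (?B *v y) = c + c * (v \<bullet> (?B *v v))"
      by (simp add: q_def distrib_left)
    \<comment> \<open>The candidate \<open>?z\<close> is tested by applying
      \<open>A + outer_self v\<close>. The choice of \<open>q\<close> makes the last coefficient
      equal to \<open>c\<close>, so the multiples of \<open>v\<close> cancel.\<close>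
    have "(A + outer_self v) *v ?z = y - c *\<^sub>R v + (v \<bullet> (?B *v y) - c * (v \<bullet> (?B *v v))) *\<^sub>R v"
      unfolding c_def
      by (simp only: matrix_vector_mult_add_rdistrib matrix_vector_mult_diff_distrib
          matrix_vector_mult_scaleR pos_def_mult_inv[OF A] outer_self_mult inner_diff_right
          inner_scaleR_right)
        (simp add: algebra_simps)
    also have "\<dots> = y"
      by (simp add: c)
    finally show ?thesis
      using pos_def_mult_inv(2)[OF pos_def_add_outer_self[OF A], of v ?z] by simp
  qed
  have "trace ?B - trace ?C
      = (\<Sum>i\<in>UNIV. ((v \<bullet> (?B *v axis i 1)) / q) * (axis i 1 \<bullet> (?B *v v)))"
    by (simp add: trace_eq_sum_axis C inner_diff_right sum_subtractf)
  also have "\<dots> = (norm (?B *v v))\<^sup>2 / q"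
    unfolding norm_sq_eq_sum_axis sum_divide_distrib
    by (simp add: pos_def_swap[OF pos_def_matrix_inv[OF A], of v] power2_eq_square inner_commute)
  finally show ?thesis
    by (simp add: q_def)
qed

text \<open>Complete the square for \<open>A\<close> at \<open>?y\<close> with \<open>c = 1\<close>:
  the form of \<open>A\<close> there is at most that of \<open>?M\<close>, which equals
  \<open>?y \<bullet> x\<close>. Consequently leverage scores never rise above their initial
  values.\<close>

lemma pos_def_inv_add_sum_le:
  assumes A: "pos_def (A :: real ^ 'd ^ 'd)" and S: "finite S"
  shows "x \<bullet> (matrix_inv (A + (\<Sum>i\<in>S. outer_self (v i))) *v x) \<le> x \<bullet> (matrix_inv A *v x)"
proof -
  let ?M = "A + (\<Sum>i\<in>S. outer_self (v i))"
  let ?y = "matrix_inv ?M *v x"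
  have M: "pos_def ?M"
    by (rule pos_def_add_sum_outer_self[OF A S])
  have "2 * (?y \<bullet> x) \<le> ?y \<bullet> (A *v ?y) + x \<bullet> (matrix_inv A *v x)"
    using pos_def_inner_le[OF A, of 1 ?y x] by simp
  also have "?y \<bullet> (A *v ?y) \<le> ?y \<bullet> (?M *v ?y)"
    by (simp only: quadratic_add_sum_outer_self[OF S]) (simp add: sum_nonneg)
  also have "?y \<bullet> (?M *v ?y) = ?y \<bullet> x"
    by (simp only: pos_def_mult_inv[OF M])
  finally show ?thesis
    by (simp add: inner_commute)
qed

section \<open>The objective: gain of one index and comparison of two sets\<close>

lemma A_objective_pos: "pos_def \<Lambda> \<Longrightarrow> finite S \<Longrightarrow> A_objective \<Lambda> v S > 0"
  unfolding A_objective_def by (intro trace_matrix_inv_pos pos_def_add_sum_outer_self)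

lemma A_objective_insert:
  fixes v :: "nat \<Rightarrow> real ^ 'd"
  assumes "pos_def \<Lambda>" "finite S" "i \<notin> S"
  defines "B \<equiv> matrix_inv (\<Lambda> + (\<Sum>i\<in>S. outer_self (v i)))"
  shows "A_objective \<Lambda> v S - A_objective \<Lambda> v (insert i S)
    = (norm (B *v v i))\<^sup>2 / (1 + v i \<bullet> (B *v v i))"
  using trace_matrix_inv_add_outer_self[OF pos_def_add_sum_outer_self[OF assms(1,2)], of v "v i"]
    assms(2,3)
  by (simp add: A_objective_def B_def add_ac)

text \<open>For each finite \<open>R\<close>, the trace of \<open>B ** ?M R ** B\<close> splits into
  \<open>?L\<close>, which comes from \<open>\<Lambda>\<close>, and \<open>?N R\<close>. At
  \<open>S\<close> it is the trace of \<open>B\<close>, since \<open>B\<close> inverts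
  \<open>?M S\<close>; at \<open>T\<close> it is bounded below by \<open>trace_sq_le\<close>.
  Subtracting removes \<open>?L\<close> and leaves at most the indices in
  \<open>T - S\<close>.\<close>

lemma A_objective_sq_le:
  fixes v :: "nat \<Rightarrow> real ^ 'd"
  assumes \<Lambda>: "pos_def \<Lambda>" and S: "finite S" and T: "finite T"
  defines "B \<equiv> matrix_inv (\<Lambda> + (\<Sum>i\<in>S. outer_self (v i)))"
  shows "(A_objective \<Lambda> v S)\<^sup>2 / A_objective \<Lambda> v T
    \<le> A_objective \<Lambda> v S + (\<Sum>i\<in>T - S. (norm (B *v v i))\<^sup>2)"
proof -
  let ?M = "\<lambda>S. \<Lambda> + (\<Sum>i\<in>S. outer_self (v i))"
  let ?N = "\<lambda>S. \<Sum>i\<in>S. (norm (B *v v i))\<^sup>2"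
  let ?L = "\<Sum>i\<in>UNIV. (B *v axis i 1) \<bullet> (\<Lambda> *v (B *v axis i 1))"
  have MS: "pos_def (?M S)"
    by (rule pos_def_add_sum_outer_self[OF \<Lambda> S])
  have B: "pos_def B"
    unfolding B_def by (rule pos_def_matrix_inv[OF MS])
  have quad: "(\<Sum>i\<in>UNIV. (B *v axis i 1) \<bullet> (?M R *v (B *v axis i 1))) = ?L + ?N R"
    if "finite R" for R
  proof -
    \<comment> \<open>By symmetry of \<open>B\<close>, summing over the basis first gives the
      squared norm of \<open>B *v v j\<close>.\<close>
    have "(\<Sum>i\<in>UNIV. \<Sum>j\<in>R. (v j \<bullet> (B *v axis i 1))\<^sup>2) = ?N R"
      by (subst sum.swap) (simp add: norm_sq_eq_sum_axis pos_def_swap[OF B, of "v _"])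
    then show ?thesis
      by (simp only: quadratic_add_sum_outer_self[OF that] sum.distrib)
  qed
  have "A_objective \<Lambda> v S = (\<Sum>i\<in>UNIV. (B *v axis i 1) \<bullet> (?M S *v (B *v axis i 1)))"
    unfolding A_objective_def B_def trace_eq_sum_axis
    by (simp only: pos_def_mult_inv[OF MS] inner_commute)
  then have fS: "A_objective \<Lambda> v S = ?L + ?N S"
    by (simp only: quad[OF S])
  have "(A_objective \<Lambda> v S)\<^sup>2 / A_objective \<Lambda> v T
      \<le> (\<Sum>i\<in>UNIV. (B *v axis i 1) \<bullet> (?M T *v (B *v axis i 1)))"
    using trace_sq_le[OF pos_def_add_sum_outer_self[OF \<Lambda> T], of B]
    by (simp add: A_objective_def B_def)
  also have "\<dots> = ?L + ?N T"
    by (rule quad[OF T])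
  also have "?N T \<le> ?N (S \<union> (T - S))"
    using S T by (intro sum_mono2) auto
  also have "\<dots> = ?N S + ?N (T - S)"
    using S T by (intro sum.union_disjoint) auto
  finally show ?thesis
    using fS by simp
qed

section \<open>Leverage scores, greedy gains and the recursion they force\<close>

lemma h_max_ge: "i \<in> {1..n} \<Longrightarrow> v i \<bullet> (matrix_inv \<Lambda> *v v i) \<le> h_max \<Lambda> v n"
  unfolding h_max_def by (rule Max_ge) auto

lemma h_max_nonneg:
  assumes "pos_def \<Lambda>" "1 \<le> n"
  shows "0 \<le> h_max \<Lambda> v n"
  using h_max_ge[of 1 n v \<Lambda>] pos_def_nonneg[OF pos_def_matrix_inv[OF assms(1)], of "v 1"] assms(2)
  by simp

lemma greedy_gain_ge:
  fixes v :: "nat \<Rightarrow> real ^ 'd"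
  assumes \<Lambda>: "pos_def \<Lambda>" and S: "S \<subseteq> {1..n}" and T: "T \<subseteq> {1..n}"
    and j: "is_arg_min (\<lambda>i. A_objective \<Lambda> v (S \<union> {i})) (\<lambda>i. i \<in> {1..n} - S) j"
  defines "f \<equiv> A_objective \<Lambda> v"
  shows "0 \<le> f S - f (insert j S)"
    and "(f S)\<^sup>2 / f T - f S \<le> card T * (1 + h_max \<Lambda> v n) * (f S - f (insert j S))"
proof -
  define B where "B = matrix_inv (\<Lambda> + (\<Sum>i\<in>S. outer_self (v i)))"
  let ?h = "h_max \<Lambda> v n" and ?g = "f S - f (insert j S)"
  have fin: "finite S" "finite T"
    using S T finite_subset by blast+
  have jS: "j \<in> {1..n} - S"
    using j by (simp add: is_arg_min_def)
  have B: "pos_def B"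
    unfolding B_def by (intro pos_def_matrix_inv pos_def_add_sum_outer_self \<Lambda> fin)
  have gain: "f S - f (insert i S) = (norm (B *v v i))\<^sup>2 / (1 + v i \<bullet> (B *v v i))"
    if "i \<notin> S" for i
    unfolding f_def B_def by (rule A_objective_insert[OF \<Lambda> fin(1) that])
  have nonneg: "0 \<le> v i \<bullet> (B *v v i)" for i
    by (rule pos_def_nonneg[OF B])
  show g: "0 \<le> ?g"
    using gain[of j] nonneg[of j] jS by simp
  have h: "0 \<le> ?h"
    using h_max_nonneg[OF \<Lambda>] jS by auto
  have le: "(norm (B *v v i))\<^sup>2 \<le> (1 + ?h) * ?g" if i: "i \<in> T - S" for i
  proof -
    have i': "i \<in> {1..n} - S"
      using i T by blast
    \<comment> \<open>Sherman--Morrison read backwards. The greedy choice of \<open>j\<close> then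
      bounds the gain of \<open>i\<close>, and the initial leverage score bounds the current
      one.\<close>
    have "(norm (B *v v i))\<^sup>2 = (1 + v i \<bullet> (B *v v i)) * (f S - f (insert i S))"
      using gain[of i] i' nonneg[of i] by (simp add: field_simps add_nonneg_eq_0_iff)
    also have "\<dots> \<le> (1 + v i \<bullet> (B *v v i)) * ?g"
      using j i' nonneg[of i] by (intro mult_left_mono) (auto simp: is_arg_min_linorder f_def)
    also have "\<dots> \<le> (1 + ?h) * ?g"
      using pos_def_inv_add_sum_le[OF \<Lambda> fin(1), of "v i" v] h_max_ge[of i n v \<Lambda>] i' g
      by (intro mult_right_mono) (auto simp: B_def)
    finally show ?thesis .
  qed
  have "(f S)\<^sup>2 / f T - f S \<le> (\<Sum>i\<in>T - S. (norm (B *v v i))\<^sup>2)"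
    using A_objective_sq_le[OF \<Lambda> fin, of v] by (simp add: f_def B_def)
  also have "\<dots> \<le> card (T - S) * ((1 + ?h) * ?g)"
    using le by (rule sum_bounded_above)
  \<comment> \<open>Passing to \<open>card T\<close> gives a constant that is the same at every
    greedy step.\<close>
  also have "\<dots> \<le> card T * ((1 + ?h) * ?g)"
    using h g fin by (intro mult_right_mono) (auto intro: card_mono)
  finally show "(f S)\<^sup>2 / f T - f S \<le> card T * (1 + ?h) * ?g"
    by (simp add: mult.assoc)
qed

text \<open>The logistic step becomes linear in the reciprocal: dividing by \<open>K * x * y\<close>
  turns \<open>x - y\<close> into a difference of \<open>c / y\<close> and
  \<open>c / x\<close>.\<close>

lemma one_minus_inverse_contract:
  fixes x y :: real
  assumes "0 < y" "y \<le> x" "0 < c" "0 < K" and step: "x\<^sup>2 / c - x \<le> K * (x - y)"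
  shows "1 - c / y \<le> (1 - 1 / K) * (1 - c / x)"
proof (cases "c \<le> x")
  case True
  have x: "x > 0"
    using assms by simp
  \<comment> \<open>One factor \<open>x\<close> is lowered to \<open>y\<close> so that the division
    by \<open>K * x * y\<close> leaves \<open>1 - c / x\<close> on the left; this needs
    \<open>c \<le> x\<close>.\<close>
  have "(x - c) * y \<le> (x - c) * x"
    using True assms by (intro mult_left_mono) auto
  also have "\<dots> = c * (x\<^sup>2 / c - x)"
    using assms by (simp add: field_simps power2_eq_square)
  also have "\<dots> \<le> c * (K * (x - y))"
    using step assms by (intro mult_left_mono) auto
  finally have "(x - c) * y / (K * x * y) \<le> c * (K * (x - y)) / (K * x * y)"
    using assms x by (intro divide_right_mono) auto
  moreover have "(x - c) * y / (K * x * y) = (1 - c / x) / K"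
    using assms x by (simp add: field_simps)
  moreover have "c * (K * (x - y)) / (K * x * y) = c / y - c / x"
    using assms x by (simp add: field_simps)
  ultimately have "(1 - c / x) / K \<le> c / y - c / x"
    by simp
  then show ?thesis
    by (simp add: algebra_simps diff_divide_distrib)
next
  case False
  \<comment> \<open>Here \<open>1 - c / x\<close> is negative, so shrinking it by
    \<open>1 - 1 / K\<close> only raises it, and \<open>y \<le> x\<close> alone suffices.\<close>
  have "c / x \<le> c / y"
    using assms by (intro divide_left_mono) auto
  moreover have "(1 - c / x) / K \<le> 0"
    using False assms by (intro divide_nonpos_pos) (auto simp: field_simps)
  ultimately show ?thesis
    by (simp add: algebra_simps diff_divide_distrib)
qed

lemma greedy_output_bound:
  fixes v :: "nat \<Rightarrow> real ^ 'd"
  assumes \<Lambda>: "pos_def \<Lambda>" and T: "T \<subseteq> {1..n}" "T \<noteq> {}"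
  defines "f \<equiv> A_objective \<Lambda> v" and "K \<equiv> card T * (1 + h_max \<Lambda> v n)"
  assumes "greedy_output f {1..n} t S"
  shows "S \<subseteq> {1..n} \<and> 1 - f T / f S \<le> (1 - 1 / K) ^ t"
  using \<open>greedy_output f {1..n} t S\<close>
proof induction
  case greedy_start
  \<comment> \<open>At \<open>t = 0\<close> the right side is 1, so positivity of the objective is
    enough and the size of the initial ratio never enters.\<close>
  show ?case
    using A_objective_pos[OF \<Lambda>, of "{}" v] A_objective_pos[OF \<Lambda> finite_subset[OF T(1)], of v]
    by (simp add: f_def less_imp_le)
next
  case (greedy_step t S j)
  have n: "1 \<le> n"
    using T by (cases n) auto
  have finT: "finite T"
    using T(1) finite_subset by blast
  \<comment> \<open>This makes \<open>1 - 1 / K\<close> nonnegative, so the induction hypothesis may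
    be multiplied by it.\<close>
  have K: "1 \<le> K"
    unfolding K_def using h_max_nonneg[OF \<Lambda> n, of v] T(2) finT
    by (intro mult_ge1_I) (auto simp: Suc_le_eq card_gt_0_iff)
  have S: "S \<subseteq> {1..n}" and j: "j \<in> {1..n}"
    using greedy_step by (auto simp: is_arg_min_def)
  note gain = greedy_gain_ge[OF \<Lambda> S T(1) greedy_step(2)[unfolded f_def], folded f_def]
  have "1 - f T / f (insert j S) \<le> (1 - 1 / K) * (1 - f T / f S)"
    using gain A_objective_pos[OF \<Lambda>, of _ v] finT finite_subset[OF S] K
    by (intro one_minus_inverse_contract) (auto simp: f_def K_def)
  also have "\<dots> \<le> (1 - 1 / K) * (1 - 1 / K) ^ t"
    using greedy_step K by (intro mult_left_mono) auto
  finally show ?case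
    using S j by simp
qed

section \<open>From the contraction rate to the constants of the bound\<close>

lemma inverse_one_minus_exp_le:
  fixes u :: real
  assumes "0 < u" "u \<le> 1"
  shows "1 / (1 - exp (- u)) \<le> 1 / u + 1 / (1 - 1 / exp 1) - 1"
proof -
  \<comment> \<open>The value \<open>?\<phi> 1\<close> is \<open>1 / (1 - 1 / exp 1) - 1\<close>, so
    monotonicity of \<open>?\<phi>\<close> gives the claim.\<close>
  let ?\<phi> = "\<lambda>u::real. 1 / (1 - exp (- u)) - 1 / u"
  have "?\<phi> u \<le> ?\<phi> 1"
  proof (rule DERIV_nonneg_imp_nondecreasing[OF assms(2)])
    fix x :: real
    assume "u \<le> x" "x \<le> 1"
    then have x: "x > 0"
      using assms by simp
    then have e: "1 - exp (- x) > 0"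
      by simp
    \<comment> \<open>This is \<open>x / 2 \<le> sinh (x / 2)\<close>. Multiplied by
      \<open>2 * exp (- x / 2)\<close> and squared, it is the sign condition on the derivative of
      \<open>?\<phi>\<close>.\<close>
    have "x / 2 \<le> (exp (x / 2) - inverse (exp (x / 2))) / 2"
      using x by (intro real_le_x_sinh) simp
    then have "exp (- x / 2) * x \<le> exp (- x / 2) * (exp (x / 2) - exp (- x / 2))"
      by (intro mult_left_mono) (auto simp: exp_minus)
    also have "\<dots> = 1 - exp (- x)"
      by (simp add: right_diff_distrib flip: exp_add)
    finally have "(exp (- x / 2) * x)\<^sup>2 \<le> (1 - exp (- x))\<^sup>2"
      using x by (intro power_mono) auto
    moreover have "(exp (- x / 2) * x)\<^sup>2 = exp (- x) * x\<^sup>2"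
      by (simp add: power_mult_distrib power2_eq_square flip: exp_add)
    ultimately have "exp (- x) * x\<^sup>2 \<le> (1 - exp (- x))\<^sup>2"
      by simp
    then have "0 \<le> 1 / x\<^sup>2 - exp (- x) / (1 - exp (- x))\<^sup>2"
      using frac_le_eq[of "(1 - exp (- x))\<^sup>2" "x\<^sup>2" "exp (- x)" 1] x e
      by (simp add: divide_nonpos_pos)
    moreover have "(?\<phi> has_real_derivative (1 / x\<^sup>2 - exp (- x) / (1 - exp (- x))\<^sup>2)) (at x)"
      using x e by (auto intro!: derivative_eq_intros simp: power2_eq_square)
    ultimately show "\<exists>y. (?\<phi> has_real_derivative y) (at x) \<and> 0 \<le> y"
      by blast
  qed
  then show ?thesis
    by (simp add: exp_minus inverse_eq_divide)
qed

theorem theorem1: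
  fixes n k :: nat
    and v :: "nat \<Rightarrow> real ^ 'd"
    and \<Lambda> :: "real ^ 'd ^ 'd"
    and S_opt S_greedy :: "nat set"
  assumes "1 \<le> n" and "1 \<le> k" and "k \<le> n"
    and "pos_def \<Lambda>"
    and "is_arg_min (A_objective \<Lambda> v) (\<lambda>S. S \<subseteq> {1..n} \<and> card S = k) S_opt"
    and "greedy_output (A_objective \<Lambda> v) {1..n} k S_greedy"
  shows "A_objective \<Lambda> v S_greedy / A_objective \<Lambda> v S_opt
           \<le> h_max \<Lambda> v n + 1 / (1 - 1 / exp 1)"
proof -
  define f h where "f = A_objective \<Lambda> v" and "h = h_max \<Lambda> v n"
  have opt: "S_opt \<subseteq> {1..n}" "card S_opt = k" "S_opt \<noteq> {}"
    using assms(2,5) by (auto simp: is_arg_min_def)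
  have h: "0 \<le> h"
    unfolding h_def using assms by (intro h_max_nonneg)
  \<comment> \<open>With \<open>card S_opt = k\<close>, the contraction factor
    \<open>1 - 1 / K\<close> becomes \<open>1 - u / k\<close>.\<close>
  define u where "u = 1 / (1 + h)"
  have u: "0 < u" "u \<le> 1" "1 / u = 1 + h"
    using h by (auto simp: u_def)
  have bound: "S_greedy \<subseteq> {1..n}" "1 - f S_opt / f S_greedy \<le> (1 - u / k) ^ k"
    using greedy_output_bound[OF assms(4) opt(1,3) assms(6)] opt(2)
    by (auto simp: f_def h_def u_def mult.commute)
  have pos: "f S_opt > 0" "f S_greedy > 0"
    unfolding f_def using opt bound assms(4) finite_subset
    by (blast intro: A_objective_pos)+
  \<comment> \<open>The base is nonnegative because \<open>u \<le> 1 \<le> k\<close>, so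
    \<open>1 - z \<le> exp (- z)\<close> can be raised to the power \<open>k\<close>.\<close>
  have "(1 - u / k) ^ k \<le> exp (- (u / k)) ^ k"
    using exp_ge_add_one_self[of "- (u / k)"] u assms(2)
    by (intro power_mono) (auto simp: field_simps)
  also have "\<dots> = exp (- u)"
    using assms(2) by (simp flip: exp_of_nat_mult)
  finally have "1 - exp (- u) \<le> f S_opt / f S_greedy"
    using bound by simp
  then have "f S_greedy / f S_opt \<le> 1 / (1 - exp (- u))"
    using pos u by (simp add: field_simps)
  \<comment> \<open>Since \<open>1 / u = 1 + h\<close>, the 1 cancels the \<open>- 1\<close> of the
    scalar estimate and exactly \<open>h\<close> is left.\<close>
  also have "\<dots> \<le> h + 1 / (1 - 1 / exp 1)"
    using inverse_one_minus_exp_le[OF u(1,2)] u(3) by simp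
  finally show ?thesis
    by (simp add: f_def h_def)
qed

end
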